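(* Let $k$ and $d$ be two positive integers such that $k\leq d$ and $d>2$. Then the Kneser graph $K_{n:k}$ with $n=\left\lfloor \frac{d(k+1)}{2}\right\rfloor+1$ satisfies $$\mathrm{Det}\left(K_{\left\lfloor \frac{d(k+1)}{2}\right\rfloor+1:k}\right)=d.$$
   Context: The Kneser graph $K_{n:k}$ has as vertices the $k$-element subsets of $[n]=\{1,\ldots,n\}$, two vertices being adjacent exactly when they are disjoint as sets. A set $S\subseteq V(G)$ of vertices of a finite graph $G$ is a determining set of $G$ if whenever $g,h\in\mathrm{Aut}(G)$ satisfy $g(s)=h(s)$ for all $s\in S$, then $g(v)=h(v)$ for all $v\in V(G)$. The determining number $\mathrm{Det}(G)$ is the minimum cardinality of a determining set of $G$. *)

theory Defs
  imports "Graph_Theory.Pair_Digraph" "HOL-Combinatorics.Permutations"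
begin

text \<open>
  A finite simple graph is a \<open>pair_graph\<close>: every edge is stored as the two arcs
  joining its endpoints.
\<close>

definition kneser_graph :: "nat \<Rightarrow> nat \<Rightarrow> nat set pair_pre_digraph" where
  "kneser_graph n k = (let V = {A. A \<subseteq> {1..n} \<and> card A = k} in
     \<lparr>pverts = V, parcs = {(A, B). A \<in> V \<and> B \<in> V \<and> A \<inter> B = {}}\<rparr>)"

lemma pair_graph_kneser_graph:
  assumes "k > 0"
  shows "pair_graph (kneser_graph n k)"
proof -
  let ?V = "{A. A \<subseteq> {1..n} \<and> card A = k}"
  have fin: "finite ?V"
    by (rule finite_subset[of _ "Pow {1..n}"]) auto
  have "finite (parcs (kneser_graph n k))"
    by (rule finite_subset[of _ "?V \<times> ?V"]) (use fin in \<open>auto simp: kneser_graph_def\<close>)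
  moreover have "finite (pverts (kneser_graph n k))"
    using fin by (simp add: kneser_graph_def)
  moreover have "symmetric (with_proj (kneser_graph n k))"
    unfolding symmetric_def by (rule symI) (simp add: kneser_graph_def Int_commute)
  moreover have "fst e \<noteq> snd e" if "e \<in> parcs (kneser_graph n k)" for e
    using that assms by (cases e) (auto simp: kneser_graph_def)
  ultimately show ?thesis
    by unfold_locales (simp_all add: kneser_graph_def case_prod_beta)
qed

text \<open>
  Automorphisms are represented as functions on the whole type which are the identity
  off the vertex set (see \<^const>\<open>permutes\<close>), so each automorphism has exactly one
  representative.
\<close>

definition graph_automorphisms :: "'a pair_pre_digraph \<Rightarrow> ('a \<Rightarrow> 'a) set" where
  "graph_automorphisms G = {g. g permutes pverts G \<and>
     (\<forall>u\<in>pverts G. \<forall>v\<in>pverts G. (g u, g v) \<in> parcs G \<longleftrightarrow> (u, v) \<in> parcs G)}"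

definition determining_set :: "'a pair_pre_digraph \<Rightarrow> 'a set \<Rightarrow> bool" where
  "determining_set G S \<longleftrightarrow> S \<subseteq> pverts G \<and>
     (\<forall>g\<in>graph_automorphisms G. \<forall>h\<in>graph_automorphisms G.
        (\<forall>s\<in>S. g s = h s) \<longrightarrow> (\<forall>v\<in>pverts G. g v = h v))"

lemma determining_set_pverts: "determining_set G (pverts G)"
  by (simp add: determining_set_def)

text \<open>
  The minimum is attained, since \<open>pverts G\<close> is itself determining. The definition is
  meant for finite \<open>G\<close>: infinite sets have cardinality 0 in HOL.
\<close>

definition determining_number :: "'a pair_pre_digraph \<Rightarrow> nat" where
  "determining_number G = (LEAST m. \<exists>S. determining_set G S \<and> card S = m)"

end

theory Submission
  imports Defs
begin

text \<open>
  For \<open>n > 2 k\<close> every automorphism of the Kneser graph comes from a permutation of the ground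
  set \<open>{1..n}\<close> (\<open>kneser_automorphism_induced_by_points\<close>). A set \<open>S\<close> of vertices is therefore
  determining exactly when it separates the points of \<open>{1..n}\<close>: no two points lie in the same
  members of \<open>S\<close>. If \<open>S\<close> separates, a permutation that maps every member of \<open>S\<close> to itself preserves
  the trace \<open>{A \<in> S. x \<in> A}\<close> of each point \<open>x\<close> and hence fixes \<open>x\<close>; if \<open>x\<close> and \<open>y\<close> have the same trace,
  their transposition fixes all members of \<open>S\<close> but is not the identity on the vertices.

  The traces turn the problem into one about families of distinct subsets of \<open>S\<close>, whose sizes
  add up to \<open>k * card S\<close> because each member of \<open>S\<close> has \<open>k\<close> points. At most one trace is empty, at
  most \<open>card S\<close> are singletons and the others have at least two elements, so that
  \<open>2 * n \<le> card S * (k + 1) + 2\<close> (\<open>separating_family_size_bound\<close>). For \<open>n = d * (k + 1) div 2 + 1\<close>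
  this forces \<open>d \<le> card S\<close>.

  A separating family of \<open>d\<close> vertices is obtained by the same duality from \<open>n\<close> distinct subsets of
  a \<open>d\<close>-element set in which every element has degree \<open>k\<close>. The empty set, all singletons, enough pairs
  and, if \<open>d * (k - 1)\<close> is odd, one triple have the right total size; the pairs suffice because
  \<open>k \<le> d\<close>. The degrees are then made equal by exchanges that keep the members distinct
  (\<open>balance_degrees\<close>).
\<close>

section \<open>Automorphisms of Johnson graphs\<close>

text \<open>
  The vertices of both the Kneser graph and the Johnson graph. Adjacency in the Johnson
  graph, that is \<open>card (A \<inter> B) = k - 1\<close>, is written below as \<open>card (A \<union> B) = Suc k\<close>.
\<close>

abbreviation layer :: "'a set \<Rightarrow> nat \<Rightarrow> 'a set set" where
  "layer V k \<equiv> {A. A \<subseteq> V \<and> card A = k}"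

lemma finite_layer: "finite V \<Longrightarrow> finite (layer V k)"
  by (rule finite_subset[of _ "Pow V"]) auto

lemma layer_eq_insert:
  assumes "finite A" "card A = Suc k" "D \<subseteq> A" "card D = k"
  obtains a where "a \<notin> D" "A = insert a D"
proof -
  have fD: "finite D" using assms finite_subset by blast
  have "card (A - D) = 1" using assms fD by (simp add: card_Diff_subset)
  then obtain a where "A - D = {a}" by (auto simp: card_1_singleton_iff)
  then have "a \<notin> D" "A = insert a D" using assms(3) by auto
  then show ?thesis using that by blast
qed

text \<open>
  A clique of a Johnson graph consists either of sets with a common core or of subsets of
  one set with \<open>k + 2\<close> elements. The second kind has at most \<open>k + 2\<close> members, so a larger clique
  is of the first kind.
\<close>

lemma large_clique_has_common_core:
  assumes Q: "\<And>A. A \<in> Q \<Longrightarrow> finite A \<and> card A = Suc k"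
    and adj: "\<And>A B. A \<in> Q \<Longrightarrow> B \<in> Q \<Longrightarrow> A \<noteq> B \<Longrightarrow> card (A \<union> B) = Suc (Suc k)"
    and big: "k + 2 < card Q"
  shows "\<exists>D. card D = k \<and> (\<forall>A\<in>Q. D \<subseteq> A)"
proof -
  have finQ: "finite Q" using big card.infinite by fastforce
  have inter: "card (A \<inter> B) = k" if "A \<in> Q" "B \<in> Q" "A \<noteq> B" for A B
    using card_Un_Int[of A B] Q[OF that(1)] Q[OF that(2)] adj[OF that] by linarith
  have "2 \<le> card Q" using big by simp
  then obtain A B where AB: "A \<in> Q" "B \<in> Q" "A \<noteq> B"
    using finQ by (metis card_le_Suc0_iff_eq not_less_eq_eq numeral_2_eq_2)
  define D where "D = A \<inter> B"
  have D: "card D = k" "finite D" using inter[OF AB] Q[OF AB(1)] by (auto simp: D_def)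
  obtain a where a: "a \<notin> D" "A = insert a D"
  proof (rule layer_eq_insert)
    show "finite A" "card A = Suc k" using Q[OF AB(1)] by simp_all
    show "D \<subseteq> A" by (simp add: D_def)
  qed (use D in simp_all)
  obtain b where b: "b \<notin> D" "B = insert b D"
  proof (rule layer_eq_insert)
    show "finite B" "card B = Suc k" using Q[OF AB(2)] by simp_all
    show "D \<subseteq> B" by (simp add: D_def)
  qed (use D in simp_all)
  have ab: "a \<noteq> b" using AB(3) a b by auto
  show ?thesis
  proof (rule ccontr)
    assume "\<not> ?thesis"
    then obtain X where X: "X \<in> Q" "\<not> D \<subseteq> X" using D by blast
    then obtain e where e: "e \<in> D" "e \<notin> X" by blast
    have XA: "X \<noteq> A" "X \<noteq> B" using X a b by auto
    have fX: "finite X" "card X = Suc k" using Q X by auto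
    have cA: "card (A - {e}) = k" and cB: "card (B - {e}) = k"
      using Q AB e a b by auto
    \<comment> \<open>A member \<open>X\<close> that omits the core element \<open>e\<close> meets \<open>A\<close> and \<open>B\<close> in all their other points,
      which leaves only one possibility for \<open>X\<close> inside \<open>A \<union> B\<close>.\<close>
    have "A - {e} = X \<inter> A"
      by (rule sym, rule card_subset_eq) (use cA inter[OF X(1) AB(1) XA(1)] Q[OF AB(1)] e in auto)
    moreover have "B - {e} = X \<inter> B"
      by (rule sym, rule card_subset_eq) (use cB inter[OF X(1) AB(2) XA(2)] Q[OF AB(2)] e in auto)
    ultimately have sub: "(A \<union> B) - {e} \<subseteq> X" by blast
    have U: "card (A \<union> B) = Suc (Suc k)" "finite (A \<union> B)" using adj[OF AB] Q AB by auto
    then have "card ((A \<union> B) - {e}) = Suc k" using e a by (auto simp: card_Diff_singleton_if)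
    then have Xeq: "X = (A \<union> B) - {e}"
      using card_subset_eq[OF fX(1) sub] fX by simp
    \<comment> \<open>A member \<open>Y\<close> with a point \<open>y\<close> outside \<open>A \<union> B\<close> would share its \<open>k\<close> other points with each of
      \<open>A\<close>, \<open>B\<close> and \<open>X\<close>, but these three have only \<open>k - 1\<close> points in common.\<close>
    have "Y \<subseteq> A \<union> B" if Y: "Y \<in> Q" for Y
    proof (rule ccontr)
      assume nY: "\<not> Y \<subseteq> A \<union> B"
      then have YAB: "Y \<noteq> A" "Y \<noteq> B" "Y \<noteq> X" using Xeq by auto
      obtain y where y: "y \<in> Y" "y \<notin> A \<union> B" using nY by blast
      have fY: "finite Y" "card Y = Suc k" using Q Y by auto
      have cy: "card (Y - {y}) = k" using fY y by simp
      have *: "Y - {y} \<subseteq> Z" if Z: "Z \<in> Q" "Z \<noteq> Y" "y \<notin> Z" for Z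
      proof -
        have "Y \<inter> Z = Y - {y}"
          by (rule card_subset_eq) (use inter[OF Y Z(1)] cy Z fY in auto)
        then show ?thesis by blast
      qed
      have "Y - {y} \<subseteq> A \<inter> B \<inter> X"
        using *[OF AB(1)] *[OF AB(2)] *[OF X(1)] YAB y Xeq by auto
      also have "\<dots> \<subseteq> D - {e}" using e by (auto simp: D_def)
      finally have "card (Y - {y}) \<le> card (D - {e})" using D by (simp add: card_mono)
      then show False using cy D e by (metis card_Diff1_less not_less)
    qed
    then have "Q \<subseteq> layer (A \<union> B) (Suc k)" using Q by blast
    then have "card Q \<le> card (layer (A \<union> B) (Suc k))"
      using finite_layer U by (intro card_mono) auto
    also have "\<dots> = k + 2" using n_subsets[OF U(2), of "Suc k"] U by simp
    finally show False using big by simp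
  qed
qed

lemma card_supersets_one_larger:
  assumes "finite V" "C \<subseteq> V"
  shows "card {A \<in> layer V (Suc (card C)). C \<subseteq> A} = card V - card C"
proof -
  have fC: "finite C" using assms finite_subset by blast
  have "{A \<in> layer V (Suc (card C)). C \<subseteq> A} = (\<lambda>x. insert x C) ` (V - C)" (is "?L = ?R")
  proof
    show "?L \<subseteq> ?R"
    proof
      fix A assume A: "A \<in> ?L"
      then have "finite A" using assms finite_subset by blast
      then obtain a where "a \<notin> C" "A = insert a C"
        by (rule layer_eq_insert) (use A in auto)
      then show "A \<in> ?R" using A by auto
    qed
    show "?R \<subseteq> ?L" using assms fC by auto
  qed
  moreover have "inj_on (\<lambda>x. insert x C) (V - C)" by (auto simp: inj_on_def)
  ultimately show ?thesis using assms fC by (simp add: card_image card_Diff_subset)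
qed

text \<open>
  Induction on \<open>k\<close>. The sets of size \<open>k + 1\<close> that contain a fixed set \<open>C\<close> of size \<open>k\<close> form a clique,
  the star of \<open>C\<close>, with \<open>card V - k\<close> members. As \<open>card V > 2 * (k + 1)\<close>, this exceeds \<open>k + 2\<close>, so the image of
  the star has a core \<open>h C\<close> of size \<open>k\<close>. The map \<open>h\<close> satisfies the hypotheses one layer below, and the point
  map obtained for \<open>h\<close> also induces \<open>f\<close>, since a set is the union of its subsets with one point less.
\<close>

lemma johnson_graph_injection_induced_by_points:
  fixes V :: "'a set"
  assumes "finite V" "0 < k" "2 * k < card V"
    and "f ` layer V k \<subseteq> layer V k" "inj_on f (layer V k)"
    and "\<And>A B. A \<in> layer V k \<Longrightarrow> B \<in> layer V k \<Longrightarrow> card (A \<union> B) = Suc k \<Longrightarrow>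
            card (f A \<union> f B) = Suc k"
  shows "\<exists>p. inj_on p V \<and> p ` V \<subseteq> V \<and> (\<forall>A\<in>layer V k. f A = p ` A)"
  using assms
proof (induction k arbitrary: f)
  case 0
  then show ?case by simp
next
  case (Suc k)
  note finV = Suc.prems(1) and big = Suc.prems(3) and into = Suc.prems(4) and inj = Suc.prems(5)
    and adj = Suc.prems(6)
  have intoD: "f A \<in> layer V (Suc k)" if "A \<in> layer V (Suc k)" for A
    using into that by (rule subsetD[OF _ imageI])
  show ?case
  proof (cases "k = 0")
    case True
    define p where "p x = the_elem (f {x})" for x
    have fp: "f {x} = {p x} \<and> p x \<in> V" if "x \<in> V" for x
    proof -
      have "f {x} \<in> layer V (Suc k)" by (rule intoD) (use that True in simp)
      then have *: "f {x} \<subseteq> V" "card (f {x}) = 1" using True by auto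
      obtain y where "f {x} = {y}" using *(2) by (rule card_1_singletonE)
      then show ?thesis using * by (simp add: p_def)
    qed
    have "inj_on p V"
    proof (rule inj_onI)
      fix x y assume xy: "x \<in> V" "y \<in> V" "p x = p y"
      then have "f {x} = f {y}" using fp by simp
      then show "x = y" using inj_onD[OF inj, of "{x}" "{y}"] xy True by simp
    qed
    moreover have "f A = p ` A" if "A \<in> layer V (Suc k)" for A
    proof -
      have "card A = 1" using that True by simp
      then obtain x where "A = {x}" by (rule card_1_singletonE)
      then show ?thesis using fp that by auto
    qed
    ultimately show ?thesis using fp by blast
  next
    case False
    define star where "star C = {A \<in> layer V (Suc k). C \<subseteq> A}" for C
    have cstar: "card (star C) = card V - k" "finite (star C)" if "C \<in> layer V k" for C
    proof -
      show "card (star C) = card V - k"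
        using card_supersets_one_larger[OF finV, of C] that by (auto simp: star_def)
      show "finite (star C)" unfolding star_def by (rule finite_subset[OF _ finite_layer[OF finV]]) auto
    qed
    have "\<exists>D. D \<in> layer V k \<and> f ` star C \<subseteq> star D" if C: "C \<in> layer V k" for C
    proof -
      have injC: "inj_on f (star C)" using inj by (rule inj_on_subset) (auto simp: star_def)
      have fin: "A \<in> layer V (Suc k) \<Longrightarrow> finite A" for A using finV finite_subset by blast
      have "\<exists>D. card D = k \<and> (\<forall>A\<in>f ` star C. D \<subseteq> A)"
      proof (rule large_clique_has_common_core)
        fix A assume "A \<in> f ` star C"
        then obtain B where "B \<in> star C" "A = f B" by blast
        then have "A \<in> layer V (Suc k)" using intoD[of B] by (simp add: star_def)
        then show "finite A \<and> card A = Suc k" using fin[of A] by simp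
      next
        fix A B assume "A \<in> f ` star C" "B \<in> f ` star C" "A \<noteq> B"
        then obtain X Y where XY: "X \<in> star C" "Y \<in> star C" "X \<noteq> Y" "A = f X" "B = f Y" by blast
        have XYl: "X \<in> layer V (Suc k)" "Y \<in> layer V (Suc k)"
          using XY(1,2) by (simp_all add: star_def)
        obtain x where x: "x \<notin> C" "X = insert x C"
        proof (rule layer_eq_insert)
          show "finite X" using fin[OF XYl(1)] .
          show "card X = Suc k" using XYl by simp
          show "C \<subseteq> X" using XY by (simp add: star_def)
          show "card C = k" using C by simp
        qed
        obtain y where y: "y \<notin> C" "Y = insert y C"
        proof (rule layer_eq_insert)
          show "finite Y" using fin[OF XYl(2)] .
          show "card Y = Suc k" using XYl by simp
          show "C \<subseteq> Y" using XY by (simp add: star_def)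
          show "card C = k" using C by simp
        qed
        have "finite C" using C finV finite_subset by blast
        then have "card (X \<union> Y) = Suc (Suc k)" using x y C XY(3) by (auto simp: card_insert_if)
        then show "card (A \<union> B) = Suc (Suc k)" using adj[OF XYl] XY(4,5) by simp
      next
        show "k + 2 < card (f ` star C)"
          using card_image[OF injC] cstar(1)[OF C] big by simp
      qed
      then obtain D where D: "card D = k" "\<forall>A\<in>f ` star C. D \<subseteq> A" by blast
      have "star C \<noteq> {}" using cstar[OF C] big by force
      then obtain A where "A \<in> star C" by blast
      then have "f A \<subseteq> V" "D \<subseteq> f A" using intoD[of A] D(2) by (simp_all add: star_def)
      then have "D \<in> layer V k" using D(1) by simp
      moreover have "f ` star C \<subseteq> star D"
      proof
        fix B assume B: "B \<in> f ` star C"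
        then obtain A where "A \<in> star C" "B = f A" by blast
        then show "B \<in> star D" using intoD[of A] D(2) B by (simp add: star_def)
      qed
      ultimately show ?thesis by blast
    qed
    then have "\<forall>C\<in>layer V k. \<exists>D. D \<in> layer V k \<and> f ` star C \<subseteq> star D" by (rule ballI)
    from bchoice[OF this] obtain h where
      "\<forall>C\<in>layer V k. h C \<in> layer V k \<and> f ` star C \<subseteq> star (h C)"
      by (elim exE)
    then have h: "\<And>C. C \<in> layer V k \<Longrightarrow> h C \<in> layer V k"
        "\<And>C. C \<in> layer V k \<Longrightarrow> f ` star C \<subseteq> star (h C)"
      by simp_all
    \<comment> \<open>All stars have the same size, so two stars that \<open>f\<close> maps into one star coincide, and
      a star determines its core.\<close>
    have hinj: "inj_on h (layer V k)"
    proof (rule inj_onI)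
      fix C C' assume C: "C \<in> layer V k" "C' \<in> layer V k" "h C = h C'"
      have sub: "star C \<union> star C' \<subseteq> layer V (Suc k)" by (auto simp: star_def)
      have "card (star C \<union> star C') = card (f ` (star C \<union> star C'))"
        using card_image[OF inj_on_subset[OF inj sub]] by simp
      also have "\<dots> \<le> card (star (h C))"
      proof (rule card_mono)
        show "finite (star (h C))" by (rule cstar(2)[OF h(1)[OF C(1)]])
        show "f ` (star C \<union> star C') \<subseteq> star (h C)"
          unfolding image_Un using h(2)[OF C(1)] h(2)[OF C(2)] C(3) by (intro Un_least) simp_all
      qed
      also have "\<dots> = card (star C)" using cstar(1)[OF h(1)[OF C(1)]] cstar(1)[OF C(1)] by simp
      finally have "star C \<union> star C' = star C"
        using cstar(2)[OF C(1)] cstar(2)[OF C(2)] by (intro card_seteq[symmetric]) auto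
      then have ss: "star C' \<subseteq> star C" by blast
      have "C \<subseteq> C'"
      proof
        fix x assume x: "x \<in> C"
        show "x \<in> C'"
        proof (rule ccontr)
          assume xn: "x \<notin> C'"
          have fC': "finite C'" using C finV finite_subset by blast
          have "\<not> V \<subseteq> insert x C'"
          proof
            assume "V \<subseteq> insert x C'"
            then have "card V \<le> card (insert x C')" using fC' by (intro card_mono) auto
            then show False using C big xn fC' by simp
          qed
          then obtain y where y: "y \<in> V" "y \<notin> C'" "y \<noteq> x" by blast
          have "insert y C' \<in> star C'" using C y fC' by (auto simp: star_def)
          with ss have "insert y C' \<in> star C" by (rule subsetD)
          then have "C \<subseteq> insert y C'" by (simp add: star_def)
          then show False using x xn y by auto
        qed
      qed
      moreover have "finite C'" using C finV finite_subset by blast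
      ultimately show "C = C'" using C by (intro card_subset_eq) auto
    qed
    \<comment> \<open>Adjacent sets \<open>C\<close> and \<open>C'\<close> have \<open>C \<union> C'\<close> in both stars, so their cores are distinct subsets of
      the single set \<open>f (C \<union> C')\<close>, which has only one more element.\<close>
    have hadj: "card (h C \<union> h C') = Suc k"
      if C: "C \<in> layer V k" "C' \<in> layer V k" "card (C \<union> C') = Suc k" for C C'
    proof -
      have "C \<union> C' \<in> star C" "C \<union> C' \<in> star C'" using C by (auto simp: star_def)
      then have "f (C \<union> C') \<in> star (h C)" "f (C \<union> C') \<in> star (h C')"
        using h(2)[OF C(1)] h(2)[OF C(2)] by (meson imageI subsetD)+
      then have sub: "h C \<union> h C' \<subseteq> f (C \<union> C')" and fl: "f (C \<union> C') \<in> layer V (Suc k)"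
        by (auto simp: star_def)
      have fin: "finite (f (C \<union> C'))" using fl finV finite_subset by blast
      have le: "card (h C \<union> h C') \<le> Suc k" using card_mono[OF fin sub] fl by simp
      have "C \<noteq> C'" using C by auto
      then have "h C \<noteq> h C'" using inj_onD[OF hinj _ C(1,2)] by (rule contrapos_nn)
      moreover have "card (h C) = k" "card (h C') = k"
        using h(1)[OF C(1)] h(1)[OF C(2)] by simp_all
      moreover have "finite (h C \<union> h C')" using fin sub finite_subset by blast
      ultimately have "k < card (h C \<union> h C')"
        by (metis card_seteq finite_Un not_less sup.cobounded1 sup.cobounded2)
      then show ?thesis using le by simp
    qed
    have "\<exists>p. inj_on p V \<and> p ` V \<subseteq> V \<and> (\<forall>A\<in>layer V k. h A = p ` A)"
    proof (rule Suc.IH)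
      show "h ` layer V k \<subseteq> layer V k" by (rule image_subsetI) (rule h(1))
    qed (use False big in \<open>simp_all add: finV hinj hadj\<close>)
    then obtain p where p: "inj_on p V" "p ` V \<subseteq> V" "\<And>A. A \<in> layer V k \<Longrightarrow> h A = p ` A"
      by (elim exE conjE) (rule that, auto)
    have "f A = p ` A" if A: "A \<in> layer V (Suc k)" for A
    proof -
      have fA: "finite A" using A finV finite_subset by blast
      have "p x \<in> f A" if x: "x \<in> A" for x
      proof -
        have "A \<noteq> {x}" using A False by auto
        then obtain y where y: "y \<in> A" "y \<noteq> x" using x by blast
        have C: "A - {y} \<in> layer V k" using A y fA by auto
        have "A \<in> star (A - {y})" using A by (auto simp: star_def)
        then have "f A \<in> star (h (A - {y}))" using h(2)[OF C] by (meson imageI subsetD)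
        then have "h (A - {y}) \<subseteq> f A" by (simp add: star_def)
        then show ?thesis using p(3)[OF C] x y by auto
      qed
      then have sub: "p ` A \<subseteq> f A" by blast
      have fl: "f A \<subseteq> V" "card (f A) = Suc k" using intoD[OF A] by simp_all
      have "inj_on p A" using p(1) by (rule inj_on_subset) (use A in simp)
      then have "card (p ` A) = card (f A)" using A fl by (simp add: card_image)
      then show ?thesis using card_subset_eq[OF finite_subset[OF fl(1) finV] sub] by simp
    qed
    then show ?thesis using p(1,2) by (intro exI[of _ p]) simp
  qed
qed

section \<open>Automorphisms of Kneser graphs\<close>

lemma binomial_strict_mono_upper:
  assumes "a < b" "0 < k" "k \<le> b"
  shows "a choose k < b choose k"
proof -
  obtain c where c: "b = Suc c" using assms by (cases b) auto
  obtain l where l: "k = Suc l" using assms by (cases k) auto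
  have "a choose k \<le> c choose k" using assms c by (intro binomial_right_mono) auto
  moreover have "0 < c choose l" using assms c l by simp
  ultimately have "a choose k < (c choose l) + (c choose Suc l)" unfolding l by linarith
  then show ?thesis by (simp add: c l)
qed

text \<open>
  Vertices \<open>A\<close> and \<open>B\<close> of the Kneser graph have \<open>n - card (A \<union> B)\<close> choose \<open>k\<close> common neighbours. Among
  distinct vertices this number is maximal exactly if \<open>card (A \<union> B) = Suc k\<close>; strictness holds because
  \<open>n - Suc k \<ge> k\<close>. Automorphisms preserve the number, hence they preserve adjacency
  in the Johnson graph.
\<close>

lemma kneser_automorphism_induced_by_points:
  assumes k: "0 < k" and n: "2 * k < n" and g: "g \<in> graph_automorphisms (kneser_graph n k)"
  shows "\<exists>p. inj_on p {1..n} \<and> p ` {1..n} \<subseteq> {1..n} \<and> (\<forall>A\<in>layer {1..n} k. g A = p ` A)"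
proof -
  let ?N = "layer {1..n} k"
  have perm: "g permutes ?N"
    and edge: "\<And>A B. A \<in> ?N \<Longrightarrow> B \<in> ?N \<Longrightarrow> g A \<inter> g B = {} \<longleftrightarrow> A \<inter> B = {}"
  proof -
    show p: "g permutes ?N"
      using g by (simp add: graph_automorphisms_def kneser_graph_def)
    fix A B assume AB: "A \<in> ?N" "B \<in> ?N"
    then have "g A \<in> ?N" "g B \<in> ?N" using permutes_in_image[OF p] by blast+
    moreover have "(g A, g B) \<in> parcs (kneser_graph n k) \<longleftrightarrow> (A, B) \<in> parcs (kneser_graph n k)"
    proof -
      have "A \<in> pverts (kneser_graph n k)" "B \<in> pverts (kneser_graph n k)"
        using AB by (simp_all add: kneser_graph_def)
      then show ?thesis using g unfolding graph_automorphisms_def by blast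
    qed
    ultimately show "g A \<inter> g B = {} \<longleftrightarrow> A \<inter> B = {}"
      using AB by (simp add: kneser_graph_def)
  qed
  define nb where "nb A B = {C \<in> ?N. C \<inter> A = {} \<and> C \<inter> B = {}}" for A B
  have cnb: "card (nb A B) = (n - card (A \<union> B)) choose k" if "A \<in> ?N" "B \<in> ?N" for A B
  proof -
    have "nb A B = layer ({1..n} - (A \<union> B)) k" by (auto simp: nb_def)
    moreover have "finite (A \<union> B)" using that finite_subset[of _ "{1..n}"] by blast
    ultimately show ?thesis using that
      by (simp add: n_subsets card_Diff_subset)
  qed
  have gnb: "nb (g A) (g B) = g ` nb A B" if "A \<in> ?N" "B \<in> ?N" for A B
  proof -
    have "C \<in> g ` nb A B" if "C \<in> nb (g A) (g B)" for C
    proof -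
      have "C \<in> g ` ?N" using that permutes_image[OF perm] by (auto simp: nb_def)
      then obtain D where "D \<in> ?N" "C = g D" by blast
      then show ?thesis using that edge \<open>A \<in> ?N\<close> \<open>B \<in> ?N\<close> by (auto simp: nb_def)
    qed
    moreover have "g D \<in> nb (g A) (g B)" if "D \<in> nb A B" for D
      using that edge \<open>A \<in> ?N\<close> \<open>B \<in> ?N\<close> permutes_in_image[OF perm, of D] by (auto simp: nb_def)
    ultimately show ?thesis by blast
  qed
  show ?thesis
  proof (rule johnson_graph_injection_induced_by_points)
    show "g ` ?N \<subseteq> ?N" using permutes_image[OF perm] by simp
    show "inj_on g ?N" using permutes_inj_on[OF perm] .
    fix A B assume AB: "A \<in> ?N" "B \<in> ?N" "card (A \<union> B) = Suc k"
    have gAB: "g A \<in> ?N" "g B \<in> ?N" using AB permutes_in_image[OF perm] by blast+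
    have "card (nb (g A) (g B)) = card (nb A B)"
      using gnb AB permutes_inj_on[OF perm] by (simp add: card_image)
    then have eq: "(n - card (g A \<union> g B)) choose k = (n - Suc k) choose k"
      using cnb AB gAB by simp
    have fin: "finite (g A \<union> g B)" using gAB finite_subset[of _ "{1..n}"] by blast
    have "A \<noteq> B" using AB by auto
    then have "g A \<noteq> g B" using permutes_inj[OF perm] by (auto dest: injD)
    then have "k < card (g A \<union> g B)"
      using fin gAB by (metis (mono_tags, lifting) card_seteq finite_Un mem_Collect_eq not_less sup.cobounded1 sup.cobounded2)
    moreover have "\<not> Suc k < card (g A \<union> g B)"
    proof
      assume "Suc k < card (g A \<union> g B)"
      then have "(n - card (g A \<union> g B)) choose k < (n - Suc k) choose k"
        using k n by (intro binomial_strict_mono_upper) auto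
      then show False using eq by simp
    qed
    ultimately show "card (g A \<union> g B) = Suc k" by simp
  qed (use k n in auto)
qed

section \<open>Determining sets and separating families\<close>

lemma determining_if_separating:
  assumes k: "0 < k" and n: "2 * k < n" and S: "S \<subseteq> layer {1..n} k"
    and sep: "\<And>x y. x \<in> {1..n} \<Longrightarrow> y \<in> {1..n} \<Longrightarrow> (\<forall>A\<in>S. x \<in> A \<longleftrightarrow> y \<in> A) \<Longrightarrow> x = y"
  shows "determining_set (kneser_graph n k) S"
proof -
  let ?N = "layer {1..n} k"
  have V: "pverts (kneser_graph n k) = ?N" by (simp add: kneser_graph_def)
  have "g A = h A" if gh: "g \<in> graph_automorphisms (kneser_graph n k)"
    "h \<in> graph_automorphisms (kneser_graph n k)" "\<forall>s\<in>S. g s = h s" and A: "A \<in> ?N" for g h A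
  proof -
    obtain p where p: "inj_on p {1..n}" "p ` {1..n} \<subseteq> {1..n}" "\<forall>A\<in>?N. g A = p ` A"
      using kneser_automorphism_induced_by_points[OF k n gh(1)] by (elim exE conjE) (rule that)
    obtain q where q: "inj_on q {1..n}" "q ` {1..n} \<subseteq> {1..n}" "\<forall>A\<in>?N. h A = q ` A"
      using kneser_automorphism_induced_by_points[OF k n gh(2)] by (elim exE conjE) (rule that)
    have "p x = q x" if x: "x \<in> {1..n}" for x
    proof -
      have "q ` {1..n} = {1..n}" using q by (intro endo_inj_surj) auto
      then obtain y where y: "y \<in> {1..n}" "q y = p x" using p(2) x by (metis (no_types) image_iff subset_iff)
      \<comment> \<open>As \<open>p\<close> and \<open>q\<close> map \<open>B\<close> onto the same set, \<open>p\<close> followed by the inverse of \<open>q\<close>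
        maps \<open>B\<close> onto itself; this composite sends \<open>x\<close> to \<open>y\<close>.\<close>
      have "x \<in> B \<longleftrightarrow> y \<in> B" if B: "B \<in> S" for B
      proof -
        have "B \<in> ?N" using B S by (rule subsetD[rotated])
        then have BN: "B \<subseteq> {1..n}" "p ` B = q ` B"
          using bspec[OF p(3)] bspec[OF q(3)] bspec[OF gh(3) B] by simp_all
        have "x \<in> B \<longleftrightarrow> p x \<in> p ` B" using inj_on_image_mem_iff[OF p(1) x BN(1)] by simp
        also have "\<dots> \<longleftrightarrow> q y \<in> q ` B" using BN y by simp
        also have "\<dots> \<longleftrightarrow> y \<in> B" using inj_on_image_mem_iff[OF q(1) y(1) BN(1)] by simp
        finally show ?thesis .
      qed
      then have "x = y" using sep x y by blast
      then show ?thesis using y by simp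
    qed
    then have "p ` A = q ` A" using A by (intro image_cong) auto
    then show ?thesis using p(3) q(3) A by simp
  qed
  then show ?thesis unfolding determining_set_def V using S by simp
qed

text \<open>
  Two points that lie in the same members of \<open>S\<close> can be exchanged without moving any member of \<open>S\<close>.
  The transposition does move a vertex that contains just one of the two points.
\<close>

lemma separating_if_determining:
  assumes k: "0 < k" and n: "k < n" and S: "determining_set (kneser_graph n k) S"
    and x: "x \<in> {1..n}" and y: "y \<in> {1..n}" and same: "\<forall>A\<in>S. x \<in> A \<longleftrightarrow> y \<in> A"
  shows "x = y"
proof (rule ccontr)
  assume xy: "x \<noteq> y"
  let ?N = "layer {1..n} k"
  have V: "pverts (kneser_graph n k) = ?N" by (simp add: kneser_graph_def)
  define t where "t = transpose x y"
  have t: "inj t" "t permutes {1..n}" "\<And>A. t ` t ` A = A"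
    using x y by (auto simp: t_def permutes_swap_id image_image)
  have tN: "t ` A \<in> ?N \<longleftrightarrow> A \<in> ?N" for A
    using t(1) permutes_image[OF t(2)] inj_image_subset_iff[OF t(1), of A "{1..n}"]
    by (auto simp: card_image inj_on_subset)
  define g where "g A = (if A \<in> ?N then t ` A else A)" for A
  have gg: "g (g A) = A" for A using tN[of A] t(3)[of A] unfolding g_def by presburger
  have "bij g" using gg by (metis bij_betw_byWitness subset_UNIV)
  then have perm: "g permutes ?N"
    by (simp add: permutes_def bij_iff g_def)
  have "g \<in> graph_automorphisms (kneser_graph n k)"
    unfolding graph_automorphisms_def V
    using perm tN by (auto simp: kneser_graph_def g_def image_Int[OF t(1), symmetric])
  moreover have "id \<in> graph_automorphisms (kneser_graph n k)"
    by (simp add: graph_automorphisms_def permutes_id)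
  moreover have "g A = id A" if "A \<in> S" for A
    using same that by (auto simp: g_def t_def)
  ultimately have "\<forall>A\<in>?N. g A = id A"
    using S unfolding determining_set_def V by blast
  then have fixed: "\<forall>A\<in>?N. g A = A" by (simp only: id_apply)
  have "k - 1 \<le> card ({1..n} - {x, y})" using xy x y n by (simp add: card_Diff_subset)
  then obtain B where B: "B \<subseteq> {1..n} - {x, y}" "card B = k - 1" "finite B"
    by (rule obtain_subset_with_card_n)
  then have A: "insert x B \<in> ?N" using x k by (auto simp: card_insert_if)
  have "t ` insert x B = insert x B" using bspec[OF fixed A] A by (simp add: g_def)
  moreover have "y \<in> t ` insert x B" by (simp add: t_def)
  ultimately show False using B xy by auto
qed

section \<open>Families of distinct subsets with prescribed degrees\<close>

lemma sum_card_eq_sum_degree: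
  assumes "finite I" "finite F" "\<And>T. T \<in> F \<Longrightarrow> T \<subseteq> I"
  shows "(\<Sum>T\<in>F. card T) = (\<Sum>i\<in>I. card {T \<in> F. i \<in> T})"
proof -
  have "(\<Sum>T\<in>F. card T) = (\<Sum>T\<in>F. \<Sum>i\<in>I. if i \<in> T then 1 else 0)"
  proof (rule sum.cong)
    fix T assume "T \<in> F"
    then have "I \<inter> T = T" using assms by blast
    then show "card T = (\<Sum>i\<in>I. if i \<in> T then 1 else 0)" using assms by (simp add: sum.If_cases Int_def[symmetric])
  qed simp
  also have "\<dots> = (\<Sum>i\<in>I. \<Sum>T\<in>F. if i \<in> T then 1 else 0)" by (rule sum.swap)
  also have "\<dots> = (\<Sum>i\<in>I. card {T \<in> F. i \<in> T})"
    using assms by (simp add: sum.If_cases Int_def)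
  finally show ?thesis .
qed

text \<open>
  Only the empty set and the singletons have less than two elements; together they fall short
  by at most \<open>2 + card I\<close>.
\<close>

lemma distinct_subsets_sum_card_lower_bound:
  assumes I: "finite I" and F: "F \<subseteq> Pow I"
  shows "2 * card F \<le> (\<Sum>T\<in>F. card T) + card I + 2"
proof -
  have finF: "finite F" using F I finite_subset by blast
  let ?s = "insert {} ((\<lambda>i. {i}) ` I)"
  have "2 * card F = (\<Sum>T\<in>F. 2)" by simp
  also have "\<dots> \<le> (\<Sum>T\<in>F. card T + (2 - card T))" by (rule sum_mono) simp
  also have "\<dots> = (\<Sum>T\<in>F. card T) + (\<Sum>T\<in>F. 2 - card T)" by (rule sum.distrib)
  also have "(\<Sum>T\<in>F. 2 - card T) = (\<Sum>T\<in>F \<inter> ?s. 2 - card T)"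
  proof (rule sum.mono_neutral_right)
    show "\<forall>T\<in>F - F \<inter> ?s. 2 - card T = 0"
    proof
      fix T assume T: "T \<in> F - F \<inter> ?s"
      then have "T \<subseteq> I" using F by blast
      then have "finite T" using I by (rule finite_subset)
      have "\<not> card T \<le> 1"
      proof
        assume "card T \<le> 1"
        then consider "card T = 0" | "card T = 1" by linarith
        then show False
        proof cases
          case 1 then show ?thesis using T \<open>finite T\<close> by simp
        next
          case 2 then obtain i where "T = {i}" by (rule card_1_singletonE)
          then show ?thesis using T \<open>T \<subseteq> I\<close> by auto
        qed
      qed
      then show "2 - card T = 0" by simp
    qed
  qed (use finF in auto)
  also have "\<dots> \<le> (\<Sum>T\<in>?s. 2 - card T)" using I by (intro sum_mono2) auto
  also have "\<dots> = 2 + (\<Sum>T\<in>(\<lambda>i. {i}) ` I. 2 - card T)" using I by (subst sum.insert) auto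
  also have "(\<Sum>T\<in>(\<lambda>i. {i}) ` I. 2 - card T) = card I"
    by (subst sum.reindex) (auto simp: inj_on_def)
  finally show ?thesis by simp
qed

text \<open>
  If not all degrees are equal to their average \<open>k\<close>, then some \<open>i\<close> has degree above \<open>k\<close> and some \<open>j\<close> has
  degree below \<open>k\<close>. More members contain \<open>i\<close> but not \<open>j\<close> than the other way round, so
  one of the former does not become another member when \<open>i\<close> is replaced by \<open>j\<close>. This exchange
  keeps the number and the sizes of the members and lowers the total excess over \<open>k\<close>.
\<close>

lemma balance_degrees:
  assumes I: "finite I"
    and "F \<subseteq> Pow I" "card F = n" "(\<Sum>T\<in>F. card T) = card I * k"
  shows "\<exists>F. F \<subseteq> Pow I \<and> card F = n \<and> (\<forall>i\<in>I. card {T \<in> F. i \<in> T} = k)"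
  using assms(2-)
\<comment> \<open>Subtraction of natural numbers truncates, so the measure counts only degrees above \<open>k\<close>.\<close>
proof (induction "\<Sum>i\<in>I. card {T \<in> F. i \<in> T} - k" arbitrary: F rule: less_induct)
  case less
  let ?deg = "\<lambda>F i. card {T \<in> F. i \<in> T}"
  have finF: "finite F" using less.prems I finite_subset by blast
  have degsum: "(\<Sum>i\<in>I. ?deg F i) = (\<Sum>i\<in>I. k)"
  proof -
    have "(\<Sum>T\<in>F. card T) = (\<Sum>i\<in>I. ?deg F i)"
      by (rule sum_card_eq_sum_degree[OF I finF]) (use less.prems(1) in blast)
    then show ?thesis using less.prems(3) by simp
  qed
  show ?case
  proof (cases "\<forall>i\<in>I. ?deg F i = k")
    case True
    then show ?thesis using less.prems by blast
  next
    case False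
    have "\<exists>i\<in>I. k < ?deg F i"
    proof (rule ccontr)
      assume "\<not> ?thesis"
      then have le: "\<forall>i\<in>I. ?deg F i \<le> k" by auto
      with False obtain i where "i \<in> I" "?deg F i < k" by force
      then have "(\<Sum>i\<in>I. ?deg F i) < (\<Sum>i\<in>I. k)" using I le by (intro sum_strict_mono_ex1) auto
      then show False using degsum by simp
    qed
    then obtain i where i: "i \<in> I" "k < ?deg F i" by blast
    have "\<exists>j\<in>I. ?deg F j < k"
    proof (rule ccontr)
      assume "\<not> ?thesis"
      then have "(\<Sum>i\<in>I. k) < (\<Sum>i\<in>I. ?deg F i)" using I i by (intro sum_strict_mono_ex1) auto
      then show False using degsum by simp
    qed
    then obtain j where j: "j \<in> I" "?deg F j < k" by blast
    have ij: "i \<noteq> j" using i j by auto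
    let ?Fi = "{T \<in> F. i \<in> T \<and> j \<notin> T}" and ?Fj = "{T \<in> F. j \<in> T \<and> i \<notin> T}"
      and ?Fij = "{T \<in> F. i \<in> T \<and> j \<in> T}"
    have "?deg F i = card ?Fi + card ?Fij"
      using finF by (subst card_Un_disjoint[symmetric]) (auto intro: arg_cong[where f = card])
    moreover have "?deg F j = card ?Fj + card ?Fij"
      using finF by (subst card_Un_disjoint[symmetric]) (auto intro: arg_cong[where f = card])
    ultimately have less_ij: "card ?Fj < card ?Fi" using i j by linarith
    define sw where "sw T = insert j (T - {i})" for T
    have "inj_on sw ?Fi"
    proof (rule inj_onI)
      fix T U assume TU: "T \<in> ?Fi" "U \<in> ?Fi" "sw T = sw U"
      then have "insert i (sw T - {j}) = insert i (sw U - {j})" by simp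
      then show "T = U" using TU by (auto simp: sw_def)
    qed
    have "\<not> sw ` ?Fi \<subseteq> F"
    proof
      assume "sw ` ?Fi \<subseteq> F"
      then have "sw ` ?Fi \<subseteq> ?Fj" using ij by (auto simp: sw_def)
      then have "card ?Fi \<le> card ?Fj"
        using \<open>inj_on sw ?Fi\<close> finF by (intro card_inj_on_le) auto
      then show False using less_ij by simp
    qed
    then obtain T where T: "T \<in> F" "i \<in> T" "j \<notin> T" "sw T \<notin> F" by blast
    define F' where "F' = insert (sw T) (F - {T})"
    have finT: "finite T" using T less.prems I finite_subset by blast
    have F'_sub: "F' \<subseteq> Pow I" using less.prems T j by (auto simp: F'_def sw_def)
    have F'_card: "card F' = n"
      using T finF less.prems(2) card_Suc_Diff1[OF finF T(1)] by (simp add: F'_def)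
    have "card (sw T) = card T" using T card_Suc_Diff1[OF finT T(2)] finT by (simp add: sw_def)
    then have F'_sum: "(\<Sum>T\<in>F'. card T) = card I * k"
      using T finF less.prems(3) by (simp add: F'_def sum.remove[of F T])
    have deg_i: "?deg F' i < ?deg F i"
    proof (rule psubset_card_mono)
      show "{U \<in> F'. i \<in> U} \<subset> {U \<in> F. i \<in> U}" using T ij by (auto simp: F'_def sw_def)
    qed (use finF in auto)
    have "{U \<in> F'. j \<in> U} \<subseteq> insert (sw T) {U \<in> F. j \<in> U}" by (auto simp: F'_def)
    then have "?deg F' j \<le> card (insert (sw T) {U \<in> F. j \<in> U})" using finF by (intro card_mono) auto
    also have "\<dots> \<le> Suc (?deg F j)" by (rule card_insert_le_m1) auto
    finally have deg_j: "?deg F' j \<le> k" using j by simp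
    have deg_other: "?deg F' l = ?deg F l" if l: "l \<noteq> i" "l \<noteq> j" for l
    proof (cases "l \<in> T")
      case True
      then have "{U \<in> F'. l \<in> U} = insert (sw T) ({U \<in> F. l \<in> U} - {T})"
        using l by (auto simp: F'_def sw_def)
      then show ?thesis
        using True T finF card_Suc_Diff1[of "{U \<in> F. l \<in> U}" T] by simp
    next
      case False
      then have "{U \<in> F'. l \<in> U} = {U \<in> F. l \<in> U}"
        using l by (auto simp: F'_def sw_def)
      then show ?thesis by simp
    qed
    have "(\<Sum>i\<in>I. ?deg F' i - k) < (\<Sum>i\<in>I. ?deg F i - k)"
    proof (rule sum_strict_mono_ex1[OF I])
      show "\<forall>l\<in>I. ?deg F' l - k \<le> ?deg F l - k"
      proof
        fix l
        show "?deg F' l - k \<le> ?deg F l - k"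
          using deg_i deg_j deg_other[of l] by (cases "l = i"; cases "l = j") auto
      qed
      show "\<exists>l\<in>I. ?deg F' l - k < ?deg F l - k"
        using i deg_i by (intro bexI[of _ i]) auto
    qed
    then show ?thesis using less.hyps F'_sub F'_card F'_sum by blast
  qed
qed

lemma exists_subset_family_with_sum:
  assumes k: "0 < k" "k \<le> d" and d: "2 < d" and I: "finite I" "card I = d"
  shows "\<exists>F. F \<subseteq> Pow I \<and> card F = d * (k + 1) div 2 + 1 \<and> (\<Sum>T\<in>F. card T) = d * k"
proof -
  \<comment> \<open>The \<open>m - r\<close> pairs and \<open>r\<close> triples are \<open>m\<close> sets of total size \<open>2 * m + r = d * (k - 1)\<close>.\<close>
  define m r where "m = d * (k - 1) div 2" and "r = d * (k - 1) mod 2"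
  have mr: "d * (k - 1) = 2 * m + r" "r \<le> 1" by (auto simp: m_def r_def)
  have "d * k = d * (k - 1) + d" using k by (cases k) auto
  then have dk: "d * k = 2 * m + r + d" unfolding mr(1) .
  \<comment> \<open>The hypothesis \<open>k \<le> d\<close> guarantees that there are enough pairs.\<close>
  have "m \<le> d * (d - 1) div 2" unfolding m_def using k by (intro div_le_mono mult_le_mono2) auto
  then have m_le: "m - r \<le> card (layer I 2)"
    using I n_subsets[OF I(1), of 2] by (simp add: choose_two)
  have "0 < d choose 3" using d by simp
  then have r_le: "r \<le> card (layer I 3)"
    using mr(2) n_subsets[OF I(1), of 3] unfolding I(2) by linarith
  have rm: "r \<le> m"
  proof (cases "k = 1")
    case True then show ?thesis by (simp add: m_def r_def)
  next
    case False
    then have "d * 1 \<le> d * (k - 1)" using k by (intro mult_le_mono2) auto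
    then show ?thesis using mr d by linarith
  qed
  obtain P where P: "P \<subseteq> layer I 2" "card P = m - r" "finite P"
    using obtain_subset_with_card_n[OF m_le] by blast
  obtain Q where Q: "Q \<subseteq> layer I 3" "card Q = r" "finite Q"
    using obtain_subset_with_card_n[OF r_le] by blast
  let ?s = "(\<lambda>i. {i}) ` I"
  define F where "F = insert {} (?s \<union> (P \<union> Q))"
  have disj: "P \<inter> Q = {}" "?s \<inter> (P \<union> Q) = {}" "{} \<notin> ?s \<union> (P \<union> Q)"
    using P Q by fastforce+
  have cs: "card ?s = d" using I by (simp add: card_image)
  have "card F = d + m + 1"
    using disj P Q I cs rm by (simp add: F_def card_Un_disjoint)
  moreover have "d * (k + 1) div 2 = d + m"
  proof -
    have "d * (k + 1) = 2 * (d + m) + r" using dk by simp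
    also have "\<dots> div 2 = d + m" using mr(2) by simp
    finally show ?thesis .
  qed
  moreover have "(\<Sum>T\<in>F. card T) = d * k"
  proof -
    have "(\<Sum>T\<in>P. card T) = (\<Sum>T\<in>P. 2)" using P by (intro sum.cong) auto
    moreover have "(\<Sum>T\<in>Q. card T) = (\<Sum>T\<in>Q. 3)" using Q by (intro sum.cong) auto
    moreover have "(\<Sum>T\<in>?s. card T) = d" using I by (subst sum.reindex) (auto simp: inj_on_def)
    ultimately have "(\<Sum>T\<in>F. card T) = d + (2 * (m - r) + 3 * r)"
      using disj P Q I by (simp add: F_def sum.union_disjoint)
    then show ?thesis using dk rm by simp
  qed
  moreover have "F \<subseteq> Pow I" using P Q by (auto simp: F_def)
  ultimately show ?thesis by auto
qed

text \<open>
  The dual of a balanced family: each point of \<open>{1..n}\<close> is labelled with its own member of the family,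
  and the \<open>i\<close>-th vertex collects the points whose label contains \<open>i\<close>. Degrees become
  sizes of vertices, and distinct labels separate the points.
\<close>

lemma exists_separating_family:
  assumes k: "0 < k" "k \<le> d" and d: "2 < d" and n: "n = d * (k + 1) div 2 + 1"
  shows "\<exists>S. S \<subseteq> layer {1..n} k \<and> card S \<le> d \<and>
    (\<forall>x\<in>{1..n}. \<forall>y\<in>{1..n}. (\<forall>A\<in>S. x \<in> A \<longleftrightarrow> y \<in> A) \<longrightarrow> x = y)"
proof -
  have "\<exists>F. F \<subseteq> Pow {..<d} \<and> card F = n \<and> (\<Sum>T\<in>F. card T) = card {..<d} * k"
    using exists_subset_family_with_sum[OF k d, of "{..<d}"] n by simp
  then have "\<exists>F. F \<subseteq> Pow {..<d} \<and> card F = n \<and> (\<forall>i\<in>{..<d}. card {T \<in> F. i \<in> T} = k)"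
    by (elim exE conjE) (rule balance_degrees[OF finite_lessThan])
  then obtain F where F: "F \<subseteq> Pow {..<d}" "card F = n" "\<forall>i\<in>{..<d}. card {T \<in> F. i \<in> T} = k"
    by (elim exE conjE)
  have "finite F" using F finite_subset by blast
  then obtain e where e: "bij_betw e {1..n} F"
    using F by (metis bij_betw_iff_card card_atLeastAtMost diff_Suc_1 finite_atLeastAtMost)
  define A where "A i = {x \<in> {1..n}. i \<in> e x}" for i
  have "card (A i) = k" if "i < d" for i
  proof -
    have "e ` A i = {T \<in> F. i \<in> T}" using e by (auto simp: A_def bij_betw_def)
    moreover have "inj_on e (A i)"
      using e by (auto simp: A_def bij_betw_def intro: inj_on_subset)
    ultimately show ?thesis using F that by (metis card_image lessThan_iff)
  qed
  then have "A ` {..<d} \<subseteq> layer {1..n} k" by (auto simp: A_def)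
  moreover have "card (A ` {..<d}) \<le> d" using card_image_le[of "{..<d}" A] by simp
  moreover have "x = y" if "x \<in> {1..n}" "y \<in> {1..n}" "\<forall>B\<in>A ` {..<d}. x \<in> B \<longleftrightarrow> y \<in> B" for x y
  proof -
    have "e x \<subseteq> {..<d}" "e y \<subseteq> {..<d}"
      using bij_betwE[OF e] that F(1) by blast+
    moreover have "i \<in> e x \<longleftrightarrow> i \<in> e y" if "i < d" for i
      using \<open>\<forall>B\<in>A ` {..<d}. x \<in> B \<longleftrightarrow> y \<in> B\<close> that \<open>x \<in> {1..n}\<close> \<open>y \<in> {1..n}\<close> by (auto simp: A_def)
    ultimately have "e x = e y" by blast
    then show ?thesis using e that by (auto simp: bij_betw_def dest: inj_onD)
  qed
  ultimately show ?thesis by (intro exI[of _ "A ` {..<d}"] conjI ballI impI)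
qed

lemma separating_family_size_bound:
  assumes S: "S \<subseteq> layer {1..n} k"
    and sep: "\<And>x y. x \<in> {1..n} \<Longrightarrow> y \<in> {1..n} \<Longrightarrow> (\<forall>A\<in>S. x \<in> A \<longleftrightarrow> y \<in> A) \<Longrightarrow> x = y"
  shows "2 * n \<le> card S * (k + 1) + 2"
proof -
  define e where "e x = {A \<in> S. x \<in> A}" for x
  have finS: "finite S" using S finite_layer[of "{1..n}"] finite_subset by blast
  have inj: "inj_on e {1..n}"
  proof (rule inj_onI)
    fix x y assume "x \<in> {1..n}" "y \<in> {1..n}" "e x = e y"
    then show "x = y" using sep[of x y] by (auto simp: e_def)
  qed
  have "2 * card (e ` {1..n}) \<le> (\<Sum>T\<in>e ` {1..n}. card T) + card S + 2"
    by (rule distinct_subsets_sum_card_lower_bound[OF finS]) (auto simp: e_def)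
  also have "(\<Sum>T\<in>e ` {1..n}. card T) = (\<Sum>x\<in>{1..n}. card {A \<in> S. x \<in> A})"
    using sum.reindex[OF inj, of card] by (simp add: e_def)
  also have "\<dots> = (\<Sum>A\<in>S. card A)"
    using S by (intro sum_card_eq_sum_degree[symmetric] finS) auto
  also have "\<dots> = (\<Sum>A\<in>S. k)" using S by (intro sum.cong) auto
  finally show ?thesis using inj by (simp add: card_image algebra_simps)
qed

section \<open>The determining number\<close>

theorem theorem3p4:
  fixes k d :: nat
  assumes "k > 0" and "d > 0" and "k \<le> d" and "d > 2"
  shows "determining_number (kneser_graph (d * (k + 1) div 2 + 1) k) = d"
proof -
  define n where "n = d * (k + 1) div 2 + 1"
  let ?G = "kneser_graph n k"
  have n2: "2 * n = d * (k + 1) + 2 \<or> 2 * n = d * (k + 1) + 1"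
    unfolding n_def by presburger
  have nk: "2 * k < n"
  proof (cases "k \<le> 2")
    case True
    then have "k = 1 \<or> k = 2" using assms by auto
    then show ?thesis using n2 assms by auto
  next
    case False
    then have "4 * d \<le> d * (k + 1)" by simp
    then show ?thesis using n2 assms by linarith
  qed
  obtain S where S: "S \<subseteq> layer {1..n} k" "card S \<le> d"
    "\<And>x y. x \<in> {1..n} \<Longrightarrow> y \<in> {1..n} \<Longrightarrow> (\<forall>A\<in>S. x \<in> A \<longleftrightarrow> y \<in> A) \<Longrightarrow> x = y"
    using exists_separating_family[OF assms(1,3,4) n_def] by blast
  have detS: "determining_set ?G S"
    using determining_if_separating[OF assms(1) nk S(1,3)] .
  have lower: "d \<le> card R" if R: "determining_set ?G R" for R
  proof (rule ccontr)
    assume "\<not> d \<le> card R"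
    then have "(card R + 1) * (k + 1) \<le> d * (k + 1)" by (intro mult_le_mono1) simp
    moreover have "2 * n \<le> card R * (k + 1) + 2"
    proof (rule separating_family_size_bound)
      show "R \<subseteq> layer {1..n} k" using R by (simp add: determining_set_def kneser_graph_def)
      show "x = y" if "x \<in> {1..n}" "y \<in> {1..n}" "\<forall>A\<in>R. x \<in> A \<longleftrightarrow> y \<in> A" for x y
        using separating_if_determining[OF assms(1) _ R that] nk by simp
    qed
    ultimately show False using n2 assms(1) by (auto simp: algebra_simps)
  qed
  have "card S = d" using S(2) lower[OF detS] by simp
  then have "determining_number ?G = d"
    unfolding determining_number_def using detS lower by (intro Least_equality) auto
  then show ?thesis by (simp add: n_def)
qed

end
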